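(* Let $q$ be a prime power and $0<a<1$. Choose a non-negative integer $n$ with probability $(1-a)a^n$, and then choose $g$ uniformly at random from $GL(n,q)$ (with $GL(0,q)$ the trivial group acting on the zero space). Then for every integer $k\ge0$, the probability that $g$ has exactly $q^k$ fixed vectors in $\mathbb{F}_q^n$ equals $$w_{AC}(p^{-k};a;p)=(ap;p)_\infty\frac{p^{k^2}a^k}{(p;p)_k(ap;p)_k},\qquad p=1/q.$$
   Context: For complex $A$, $B$ and integer $m\ge0$, $(A;B)_m=(1-A)(1-AB)\cdots(1-AB^{m-1})$ (with $(A;B)_0=1$), and for $|B|<1$, $(A;B)_\infty=\prod_{r\ge0}(1-AB^r)$. The weight $w_{AC}(p^{-k};a;p)$ is the Al-Salam–Carlitz probability weight. *)

theory Defs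
  imports
    "HOL-Probability.Probability"
    "Jordan_Normal_Form.Matrix"
begin

definition qpoch :: "'a::comm_ring_1 \<Rightarrow> 'a \<Rightarrow> nat \<Rightarrow> 'a" where
  "qpoch A B m = (\<Prod>r<m. 1 - A * B ^ r)"

text \<open>Meaningful only for \<open>norm B < 1\<close>, where the product converges.\<close>

definition qpoch_inf :: "'a::real_normed_field \<Rightarrow> 'a \<Rightarrow> 'a" where
  "qpoch_inf A B = (\<Prod>r. 1 - A * B ^ r)"

text \<open>
  The Al-Salam--Carlitz weight is supported on the points \<open>x = p ^ (-k)\<close> with \<open>k\<close> a natural number.
  For \<open>0 < p < 1\<close> these are pairwise distinct, so that the index \<open>k\<close> is determined by \<open>x\<close>.
\<close>

definition w_AC :: "real \<Rightarrow> real \<Rightarrow> real \<Rightarrow> real" where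
  "w_AC x a p =
     (if \<exists>k::nat. x = p powi (- int k)
      then let k = (THE k::nat. x = p powi (- int k))
           in qpoch_inf (a * p) p * (p ^ (k\<^sup>2) * a ^ k / (qpoch p p k * qpoch (a * p) p k))
      else 0)"

definition GL :: "nat \<Rightarrow> 'a::field mat set" where
  "GL n = {g \<in> carrier_mat n n. invertible_mat g}"

definition fixed_vecs :: "'a::field mat \<Rightarrow> 'a vec set" where
  "fixed_vecs g = {v \<in> carrier_vec (dim_row g). g *\<^sub>v v = v}"

text \<open>
  \<open>geometric_pmf s\<close> gives \<open>n\<close> the mass \<open>(1 - s) ^ n * s\<close>, hence the parameter \<open>1 - a\<close>.
  The dimension \<open>n\<close> that was drawn is recorded in the matrix itself.
\<close>

definition random_GL :: "real \<Rightarrow> 'a::{field,finite} mat pmf" where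
  "random_GL a = bind_pmf (geometric_pmf (1 - a)) (\<lambda>n. pmf_of_set (GL n))"

end

theory Submission
  imports Defs "Jordan_Normal_Form.Determinant"
begin

text \<open>
  Let \<open>X\<close> be the number of vectors fixed by a uniform element of \<open>GL(n, q)\<close>. The fixed space
  contains \<open>(X - 1) (X - q) \<cdots> (X - q ^ (j - 1))\<close> linearly independent \<open>j\<close>-tuples, so by
  Burnside's lemma the mean of this product is the number of orbits of \<open>GL(n, q)\<close> on independent
  \<open>j\<close>-tuples, which is \<open>1\<close> for \<open>j \<le> n\<close> and \<open>0\<close> otherwise. On powers of \<open>q\<close>, a telescoping sum
  expands the indicator of \<open>X = q ^ k\<close> in these products. Averaging over the geometric \<open>n\<close>
  replaces the \<open>j\<close>-th mean by \<open>a ^ j\<close>, and the resulting series in \<open>a\<close> is Euler's expansion of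
  \<open>(a p ^ (k + 1); p)\<close>-infinity.
\<close>

section \<open>Linearly independent lists over a finite field\<close>

definition vec_subspace :: "nat \<Rightarrow> 'a::field vec set \<Rightarrow> bool" where
  "vec_subspace n W \<longleftrightarrow> W \<subseteq> carrier_vec n \<and> 0\<^sub>v n \<in> W \<and>
     (\<forall>v\<in>W. \<forall>w\<in>W. v + w \<in> W) \<and> (\<forall>c. \<forall>v\<in>W. c \<cdot>\<^sub>v v \<in> W)"

fun list_span :: "nat \<Rightarrow> 'a::field vec list \<Rightarrow> 'a vec set" where
  "list_span n [] = {0\<^sub>v n}"
| "list_span n (v # vs) = (\<lambda>(c, w). c \<cdot>\<^sub>v v + w) ` (UNIV \<times> list_span n vs)"

text \<open>This recursive form stands in for vanishing linear combinations: lists grow by one head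
  at a time, which is how they are counted and completed to bases, and tails stay
  independent.\<close>

fun lin_ind_list :: "nat \<Rightarrow> 'a::field vec list \<Rightarrow> bool" where
  "lin_ind_list n [] = True"
| "lin_ind_list n (v # vs) = (v \<notin> list_span n vs \<and> lin_ind_list n vs)"

definition ind_lists :: "nat \<Rightarrow> 'a::field vec set \<Rightarrow> nat \<Rightarrow> 'a vec list set" where
  "ind_lists n W j = {vs. length vs = j \<and> set vs \<subseteq> W \<and> lin_ind_list n vs}"

lemma one_less_card_field: "1 < CARD('a::{field,finite})"
  using card_mono[of "UNIV :: 'a set" "{0, 1}"] by simp

lemma vec_subspace_carrier [simp]: "vec_subspace n (carrier_vec n)"
  by (auto simp: vec_subspace_def)

lemma vec_subspace_list_span:
  assumes "set vs \<subseteq> carrier_vec n"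
  shows "vec_subspace n (list_span n vs)"
  using assms
proof (induction vs)
  case Nil
  then show ?case by (auto simp: vec_subspace_def)
next
  case (Cons v vs)
  have v: "v \<in> carrier_vec n" and S: "vec_subspace n (list_span n vs)"
    using Cons by auto
  have wc: "w \<in> carrier_vec n" if "w \<in> list_span n vs" for w
    using S that by (auto simp: vec_subspace_def)
  have mem: "c \<cdot>\<^sub>v v + w \<in> list_span n (v # vs)" if "w \<in> list_span n vs" for c w
    using that by auto
  have "0\<^sub>v n = 0 \<cdot>\<^sub>v v + 0\<^sub>v n"
    using v by auto
  then have zero: "0\<^sub>v n \<in> list_span n (v # vs)"
    using mem[of "0\<^sub>v n" 0] S by (auto simp: vec_subspace_def)
  have add: "(c \<cdot>\<^sub>v v + w) + (d \<cdot>\<^sub>v v + u) \<in> list_span n (v # vs)"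
    if "w \<in> list_span n vs" "u \<in> list_span n vs" for c d w u
  proof -
    have "(c \<cdot>\<^sub>v v + w) + (d \<cdot>\<^sub>v v + u) = (c + d) \<cdot>\<^sub>v v + (w + u)"
      using v wc[OF that(1)] wc[OF that(2)] by (intro eq_vecI) (auto simp: algebra_simps)
    then show ?thesis
      using mem[of "w + u" "c + d"] S that by (auto simp: vec_subspace_def)
  qed
  have smult: "d \<cdot>\<^sub>v (c \<cdot>\<^sub>v v + w) \<in> list_span n (v # vs)" if "w \<in> list_span n vs" for c d w
  proof -
    have "d \<cdot>\<^sub>v (c \<cdot>\<^sub>v v + w) = (d * c) \<cdot>\<^sub>v v + d \<cdot>\<^sub>v w"
      using v wc[OF that] by (intro eq_vecI) (auto simp: algebra_simps)
    then show ?thesis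
      using mem[of "d \<cdot>\<^sub>v w" "d * c"] S that by (auto simp: vec_subspace_def)
  qed
  have "list_span n (v # vs) \<subseteq> carrier_vec n"
    using v wc by auto
  then show ?case
    unfolding vec_subspace_def using zero add smult by fastforce
qed

lemma list_span_subset:
  assumes "vec_subspace n W" "set vs \<subseteq> W"
  shows "list_span n vs \<subseteq> W"
  using assms(2)
proof (induction vs)
  case Nil
  then show ?case using assms(1) by (auto simp: vec_subspace_def)
next
  case (Cons v vs)
  then show ?case using assms(1)
    unfolding vec_subspace_def list_span.simps by (intro image_subsetI) (clarsimp, blast)
qed

lemma carrier_vec_eq_image: "(carrier_vec n :: 'a vec set) = vec_of_list ` {xs. set xs \<subseteq> UNIV \<and> length xs = n}"
proof
  show "(carrier_vec n :: 'a vec set) \<subseteq> vec_of_list ` {xs. set xs \<subseteq> UNIV \<and> length xs = n}"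
  proof
    fix v :: "'a vec" assume "v \<in> carrier_vec n"
    then have "v = vec_of_list (list_of_vec v)" "length (list_of_vec v) = n"
      by (auto simp: vec_list)
    then show "v \<in> vec_of_list ` {xs. set xs \<subseteq> UNIV \<and> length xs = n}" by blast
  qed
qed (auto intro: carrier_vecI)

lemma finite_carrier_vec [simp]: "finite (carrier_vec n :: 'a::finite vec set)"
  unfolding carrier_vec_eq_image using finite_lists_length_eq[of "UNIV :: 'a set" n] by simp

lemma card_carrier_vec: "card (carrier_vec n :: 'a::finite vec set) = CARD('a) ^ n"
proof -
  have "inj_on vec_of_list {xs :: 'a list. set xs \<subseteq> UNIV \<and> length xs = n}"
    by (rule inj_on_inverseI[of _ list_of_vec]) (simp add: list_vec)
  then show ?thesis
    unfolding carrier_vec_eq_image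
    using card_lists_length_eq[of "UNIV :: 'a set" n] by (simp add: card_image)
qed

text \<open>Representations over an independent list are unique, so each new head multiplies the
  size of the span by \<open>CARD('a)\<close>.\<close>

lemma card_list_span:
  fixes vs :: "'a::{field,finite} vec list"
  assumes "set vs \<subseteq> carrier_vec n" "lin_ind_list n vs"
  shows "card (list_span n vs) = CARD('a) ^ length vs"
  using assms
proof (induction vs)
  case (Cons v vs)
  have v: "v \<in> carrier_vec n" and S: "vec_subspace n (list_span n vs)"
    using Cons.prems vec_subspace_list_span[of vs n] by auto
  have wc: "w \<in> carrier_vec n" if "w \<in> list_span n vs" for w
    using S that by (auto simp: vec_subspace_def)
  have "inj_on (\<lambda>(c, w). c \<cdot>\<^sub>v v + w) (UNIV \<times> list_span n vs)"
  proof (rule inj_onI, clarify)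
    fix c w d u
    assume w: "w \<in> list_span n vs" and u: "u \<in> list_span n vs"
      and eq: "c \<cdot>\<^sub>v v + w = d \<cdot>\<^sub>v v + u"
    have eqi: "c * v $ i + w $ i = d * v $ i + u $ i" if "i < n" for i
      using arg_cong[OF eq, of "\<lambda>x. x $ i"] that v wc[OF w] wc[OF u] by auto
    have "c = d"
    proof (rule ccontr)
      assume "c \<noteq> d"
      \<comment> \<open>Two representations with distinct \<open>c\<close> and \<open>d\<close>
        could be solved for \<open>v\<close>, placing it in the span of the tail.\<close>
      have "v = inverse (c - d) \<cdot>\<^sub>v (u + (- 1) \<cdot>\<^sub>v w)"
      proof (rule eq_vecI)
        fix i assume "i < dim_vec (inverse (c - d) \<cdot>\<^sub>v (u + (- 1) \<cdot>\<^sub>v w))"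
        then have i: "i < n" using wc[OF w] by auto
        have "(c - d) * v $ i = u $ i - w $ i"
          using eqi[OF i] by (simp add: algebra_simps)
        then show "v $ i = (inverse (c - d) \<cdot>\<^sub>v (u + (- 1) \<cdot>\<^sub>v w)) $ i"
          using \<open>c \<noteq> d\<close> i wc[OF w] wc[OF u] by (simp add: field_simps)
      qed (use v wc[OF w] wc[OF u] in auto)
      moreover have "inverse (c - d) \<cdot>\<^sub>v (u + (- 1) \<cdot>\<^sub>v w) \<in> list_span n vs"
        using S w u unfolding vec_subspace_def by blast
      ultimately show False using Cons.prems by simp
    qed
    moreover have "w = u"
      using eqi \<open>c = d\<close> wc[OF w] wc[OF u] by (intro eq_vecI) auto
    ultimately show "c = d \<and> w = u" by simp
  qed
  then show ?case
    using Cons by (simp add: card_image card_cartesian_product)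
qed simp

section \<open>Counting independent lists and the vectors of a subspace\<close>

lemma finite_vec_subspace:
  assumes "vec_subspace n (W :: 'a::{field,finite} vec set)"
  shows "finite W"
  using assms finite_subset[OF _ finite_carrier_vec] by (auto simp: vec_subspace_def)

lemma finite_ind_lists: "finite W \<Longrightarrow> finite (ind_lists n W j)"
  by (rule finite_subset[OF _ finite_lists_length_eq[of W j]]) (auto simp: ind_lists_def)

text \<open>An independent list of length \<open>j + 1\<close> is one of length \<open>j\<close>
  with a head outside its span, which has \<open>CARD('a) ^ j\<close> elements. For \<open>j\<close>
  beyond the dimension of \<open>W\<close> a factor is zero, in agreement with the absence of such
  lists.\<close>

lemma card_ind_lists:
  fixes W :: "'a::{field,finite} vec set"
  assumes W: "vec_subspace n W"
  shows "real (card (ind_lists n W j)) = (\<Prod>i<j. real (card W) - real CARD('a) ^ i)"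
proof (induction j)
  case 0
  have "ind_lists n W 0 = {[]}" by (auto simp: ind_lists_def)
  then show ?case by simp
next
  case (Suc j)
  have fW: "finite W" using W by (rule finite_vec_subspace)
  have "ind_lists n W (Suc j) = (\<lambda>(vs, v). v # vs) ` (SIGMA vs:ind_lists n W j. W - list_span n vs)"
    (is "?L = ?f ` ?S")
  proof
    show "?L \<subseteq> ?f ` ?S"
    proof
      fix x assume x: "x \<in> ?L"
      then obtain v vs where "x = v # vs" by (cases x) (auto simp: ind_lists_def)
      then have "(vs, v) \<in> ?S" "x = ?f (vs, v)" using x by (auto simp: ind_lists_def)
      then show "x \<in> ?f ` ?S" by blast
    qed
  qed (auto simp: ind_lists_def)
  moreover have "inj_on ?f ?S" by (auto simp: inj_on_def)
  ultimately have "card (ind_lists n W (Suc j)) = card ?S" by (simp add: card_image)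
  also have "\<dots> = (\<Sum>vs\<in>ind_lists n W j. card (W - list_span n vs))"
    using fW by (intro card_SigmaI) (auto simp: finite_ind_lists)
  finally have "real (card (ind_lists n W (Suc j)))
      = (\<Sum>vs\<in>ind_lists n W j. real (card (W - list_span n vs)))"
    by simp
  also have "\<dots> = (\<Sum>vs\<in>ind_lists n W j. real (card W) - real CARD('a) ^ j)"
  proof (rule sum.cong[OF refl])
    fix vs assume vs: "vs \<in> ind_lists n W j"
    have sub: "list_span n vs \<subseteq> W"
      using list_span_subset[OF W] vs by (auto simp: ind_lists_def)
    have "card (list_span n vs) = CARD('a) ^ j"
      using card_list_span[of vs n] vs W by (auto simp: ind_lists_def vec_subspace_def)
    moreover have "card (list_span n vs) \<le> card W" using sub fW by (rule card_mono[rotated])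
    ultimately show "real (card (W - list_span n vs)) = real (card W) - real CARD('a) ^ j"
      using sub fW by (simp add: card_Diff_subset finite_subset of_nat_diff)
  qed
  finally show ?case using Suc by simp
qed

text \<open>No basis is chosen: \<open>n + 1\<close> independent vectors would span more than all of
  \<open>carrier_vec n\<close>, so the number of such lists is zero, and the vanishing factor of the
  counting product gives the exponent \<open>m\<close>.\<close>

lemma card_vec_subspace:
  fixes W :: "'a::{field,finite} vec set"
  assumes W: "vec_subspace n W"
  obtains m where "m \<le> n" "card W = CARD('a) ^ m"
proof -
  note q = one_less_card_field[where 'a = 'a]
  have "ind_lists n W (Suc n) = {}"
  proof (rule ccontr)
    assume "ind_lists n W (Suc n) \<noteq> {}"
    then obtain vs where vs: "length vs = Suc n" "set vs \<subseteq> W" "lin_ind_list n vs"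
      by (auto simp: ind_lists_def)
    then have c: "set vs \<subseteq> carrier_vec n" using W by (auto simp: vec_subspace_def)
    have "card (list_span n vs) \<le> card (carrier_vec n :: 'a vec set)"
      by (intro card_mono list_span_subset c) auto
    then have "CARD('a) ^ Suc n \<le> CARD('a) ^ n"
      using card_list_span[OF c vs(3)] vs(1) by (simp add: card_carrier_vec)
    then have "Suc n \<le> n" by (rule power_le_imp_le_exp[OF q])
    then show False by simp
  qed
  then have "(\<Prod>i<Suc n. real (card W) - real CARD('a) ^ i) = 0"
    using card_ind_lists[OF W, of "Suc n"] by simp
  then obtain i where "i < Suc n" "real (card W) = real CARD('a) ^ i"
    by (subst (asm) prod_zero_iff) auto
  then show thesis
    using that[of i] by (metis less_Suc_eq_le of_nat_eq_iff of_nat_power)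
qed

text \<open>While \<open>j < n\<close>, the span has only \<open>CARD('a) ^ j\<close> of the
  \<open>CARD('a) ^ n\<close> vectors, so another vector can be put in front. The induction runs
  downwards from \<open>n\<close>.\<close>

lemma ind_list_extend:
  fixes vs :: "'a::{field,finite} vec list"
  assumes "vs \<in> ind_lists n (carrier_vec n) j" "j \<le> n"
  shows "\<exists>us. us @ vs \<in> ind_lists n (carrier_vec n) n"
  using assms(2,1)
proof (induction j arbitrary: vs rule: inc_induct)
  case base
  then show ?case by (metis append_Nil)
next
  case (step j)
  note q = one_less_card_field[where 'a = 'a]
  have vs: "length vs = j" "set vs \<subseteq> carrier_vec n" "lin_ind_list n vs"
    using step.prems by (auto simp: ind_lists_def)
  have "card (list_span n vs) \<noteq> card (carrier_vec n :: 'a vec set)"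
    unfolding card_list_span[OF vs(2,3)] vs(1) card_carrier_vec
    using power_strict_increasing[OF step.hyps(2) q] by simp
  moreover have "list_span n vs \<subseteq> carrier_vec n" by (intro list_span_subset vs) auto
  ultimately have "list_span n vs \<subset> carrier_vec n" by (metis psubsetI)
  from psubset_imp_ex_mem[OF this] obtain v where "v \<in> carrier_vec n - list_span n vs" ..
  then have "v # vs \<in> ind_lists n (carrier_vec n) (Suc j)"
    using vs by (auto simp: ind_lists_def)
  from step.IH[OF this] obtain us where "us @ v # vs \<in> ind_lists n (carrier_vec n) n" by blast
  then show ?case by (intro exI[of _ "us @ [v]"]) simp
qed

section \<open>The action of the general linear group\<close>

lemma GL_carrier: "g \<in> GL n \<Longrightarrow> g \<in> carrier_mat n n"
  by (simp add: GL_def)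

lemma mem_GL_iff: "g \<in> GL n \<longleftrightarrow> g \<in> carrier_mat n n \<and> (\<exists>h\<in>carrier_mat n n. g * h = 1\<^sub>m n \<and> h * g = 1\<^sub>m n)"
proof
  assume g: "g \<in> GL n"
  then have gc: "g \<in> carrier_mat n n" by (simp add: GL_def)
  from g obtain h where h: "g * h = 1\<^sub>m n" "h * g = 1\<^sub>m (dim_row h)"
    by (auto simp: GL_def invertible_mat_def inverts_mat_def)
  \<comment> \<open>The size of the inverse is not part of \<open>invertible_mat\<close>; comparing
    column counts forces \<open>h\<close> to be square of size \<open>n\<close>.\<close>
  have "dim_col h = n" using arg_cong[OF h(1), of dim_col] by simp
  moreover have "dim_row h = n" using arg_cong[OF h(2), of dim_col] gc by simp
  ultimately show "g \<in> carrier_mat n n \<and> (\<exists>h\<in>carrier_mat n n. g * h = 1\<^sub>m n \<and> h * g = 1\<^sub>m n)"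
    using gc h by (auto intro!: bexI[of _ h])
qed (auto simp: GL_def invertible_mat_def inverts_mat_def)

lemma GL_inverse:
  assumes "g \<in> GL n"
  obtains h where "h \<in> GL n" "g * h = 1\<^sub>m n" "h * g = 1\<^sub>m n"
  using assms by (auto simp: mem_GL_iff)

lemma GL_mult:
  assumes "g \<in> GL n" "h \<in> GL n"
  shows "g * h \<in> GL n"
proof -
  obtain g' where g': "g' \<in> GL n" "g * g' = 1\<^sub>m n" "g' * g = 1\<^sub>m n" by (rule GL_inverse[OF assms(1)])
  obtain h' where h': "h' \<in> GL n" "h * h' = 1\<^sub>m n" "h' * h = 1\<^sub>m n" by (rule GL_inverse[OF assms(2)])
  have c: "g \<in> carrier_mat n n" "h \<in> carrier_mat n n" "g' \<in> carrier_mat n n" "h' \<in> carrier_mat n n"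
    using assms g' h' by (auto simp: GL_carrier)
  have "g * h * (h' * g') = g * (h * h') * g'" "h' * g' * (g * h) = h' * (g' * g) * h"
    using c by (simp_all add: assoc_mult_mat[of _ n n _ n _ n])
  then have "g * h * (h' * g') = 1\<^sub>m n" "h' * g' * (g * h) = 1\<^sub>m n"
    using c g' h' by simp_all
  then show ?thesis using c unfolding mem_GL_iff by (meson mult_carrier_mat)
qed

lemma one_mem_GL: "1\<^sub>m n \<in> GL n"
  by (auto simp: mem_GL_iff intro!: bexI[of _ "1\<^sub>m n"])

lemma finite_GL: "finite (GL n :: 'a::{field,finite} mat set)"
proof (rule finite_imageD)
  have "cols ` (GL n :: 'a mat set) \<subseteq> {vs. set vs \<subseteq> carrier_vec n \<and> length vs = n}"
    by (auto simp: GL_def cols_def)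
  then show "finite (cols ` (GL n :: 'a mat set))"
    using finite_lists_length_eq[OF finite_carrier_vec] by (rule finite_subset)
  show "inj_on cols (GL n :: 'a mat set)"
    by (rule inj_on_inverseI[of _ "mat_of_cols n"]) (auto simp: GL_def)
qed

lemma mult_mat_zero_vec:
  fixes g :: "'a::semiring_0 mat"
  assumes "g \<in> carrier_mat n m"
  shows "g *\<^sub>v 0\<^sub>v m = 0\<^sub>v n"
  using assms by (intro eq_vecI) auto

lemma map_mult_mat_vec:
  assumes "g \<in> carrier_mat n n" "h \<in> carrier_mat n n" "set vs \<subseteq> carrier_vec n"
  shows "map ((*\<^sub>v) (g * h)) vs = map ((*\<^sub>v) g) (map ((*\<^sub>v) h) vs)"
  using assms by auto

lemma map_one_mat_vec:
  fixes vs :: "'a::semiring_1 vec list"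
  shows "set vs \<subseteq> carrier_vec n \<Longrightarrow> map ((*\<^sub>v) (1\<^sub>m n)) vs = vs"
  by (rule map_idI) auto

lemma list_span_map:
  assumes g: "g \<in> carrier_mat n n" and "set vs \<subseteq> carrier_vec n"
  shows "list_span n (map ((*\<^sub>v) g) vs) = (*\<^sub>v) g ` list_span n vs"
  using assms(2)
proof (induction vs)
  case Nil
  then show ?case using mult_mat_zero_vec[OF g] by simp
next
  case (Cons v vs)
  have "g *\<^sub>v (c \<cdot>\<^sub>v v + w) = c \<cdot>\<^sub>v (g *\<^sub>v v) + g *\<^sub>v w" if "w \<in> list_span n vs" for c w
  proof -
    have "w \<in> carrier_vec n"
      using that vec_subspace_list_span[of vs n] Cons.prems by (auto simp: vec_subspace_def)
    then show ?thesis using Cons.prems g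
      by (simp add: mult_add_distrib_mat_vec[OF g] mult_mat_vec[OF g])
  qed
  then show ?case using Cons by (force simp: image_iff)
qed

lemma GL_inj_on: "g \<in> GL n \<Longrightarrow> inj_on ((*\<^sub>v) g) (carrier_vec n)"
proof -
  assume g: "g \<in> GL n"
  then obtain h where h: "h \<in> GL n" "h * g = 1\<^sub>m n" by (rule GL_inverse)
  have "h *\<^sub>v (g *\<^sub>v v) = v" if "v \<in> carrier_vec n" for v
    using assoc_mult_mat_vec[OF GL_carrier[OF h(1)] GL_carrier[OF g] that] h(2) that by simp
  then show ?thesis by (rule inj_on_inverseI)
qed

lemma GL_ind_lists:
  assumes g: "g \<in> GL n" and "vs \<in> ind_lists n (carrier_vec n) j"
  shows "map ((*\<^sub>v) g) vs \<in> ind_lists n (carrier_vec n) j"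
proof -
  have "set vs \<subseteq> carrier_vec n" "lin_ind_list n vs"
    using assms by (auto simp: ind_lists_def)
  then have "lin_ind_list n (map ((*\<^sub>v) g) vs)"
  proof (induction vs)
    case (Cons v vs)
    have "list_span n vs \<subseteq> carrier_vec n" using Cons.prems by (intro list_span_subset) auto
    then have "g *\<^sub>v v \<notin> (*\<^sub>v) g ` list_span n vs"
      using inj_on_image_mem_iff[OF GL_inj_on[OF g], of v "list_span n vs"] Cons.prems by auto
    then show ?case
      using Cons list_span_map[OF GL_carrier[OF g], of vs] by auto
  qed simp
  then show ?thesis using assms GL_carrier[OF g] by (auto simp: ind_lists_def)
qed

section \<open>Transitivity on independent lists\<close>

lemma mult_mat_unit_vec:
  fixes g :: "'a::field mat"
  assumes "g \<in> carrier_mat n n" "i < n"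
  shows "g *\<^sub>v unit_vec n i = col g i"
  using assms by (intro eq_vecI) auto

text \<open>The standard basis can be sent to any prescribed list, so it serves as the meeting point
  between two arbitrary bases.\<close>

lemma map_mat_of_cols_unit_vecs:
  fixes xs :: "'a::field vec list"
  assumes "length xs = n" "set xs \<subseteq> carrier_vec n"
  shows "map ((*\<^sub>v) (mat_of_cols n xs)) (map (unit_vec n) [0..<n]) = xs"
proof (rule nth_equalityI)
  fix i assume "i < length (map ((*\<^sub>v) (mat_of_cols n xs)) (map (unit_vec n) [0..<n]))"
  then have "i < n" by simp
  then show "map ((*\<^sub>v) (mat_of_cols n xs)) (map (unit_vec n) [0..<n]) ! i = xs ! i"
    using assms mult_mat_unit_vec[of "mat_of_cols n xs" n i] nth_mem[of i xs] mat_of_cols_carrier(1)[of n xs]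
    by (simp add: subset_iff)
qed (simp add: assms)

text \<open>The span of the columns has full size, so multiplication by the matrix is onto and, by
  finiteness, injective; a vanishing determinant would give a nonzero kernel vector.\<close>

lemma mat_of_basis_GL:
  fixes bs :: "'a::{field,finite} vec list"
  assumes "bs \<in> ind_lists n (carrier_vec n) n"
  shows "mat_of_cols n bs \<in> GL n" (is "?g \<in> _")
proof -
  have bs: "length bs = n" "set bs \<subseteq> carrier_vec n" "lin_ind_list n bs"
    using assms by (auto simp: ind_lists_def)
  have g: "?g \<in> carrier_mat n n" using bs by auto
  let ?U = "map (unit_vec n) [0..<n] :: 'a vec list"
  have U: "set ?U \<subseteq> carrier_vec n" by auto
  have "map ((*\<^sub>v) ?g) ?U = bs" by (rule map_mat_of_cols_unit_vecs[OF bs(1,2)])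
  then have "list_span n bs = (*\<^sub>v) ?g ` list_span n ?U"
    using list_span_map[OF g U] by simp
  also have "\<dots> \<subseteq> (*\<^sub>v) ?g ` carrier_vec n"
    by (intro image_mono list_span_subset U) auto
  finally have "CARD('a) ^ n \<le> card ((*\<^sub>v) ?g ` carrier_vec n)"
    using card_list_span[OF bs(2,3)] bs(1) card_mono[of "(*\<^sub>v) ?g ` carrier_vec n" "list_span n bs"]
    by simp
  moreover have "card ((*\<^sub>v) ?g ` carrier_vec n) \<le> card (carrier_vec n :: 'a vec set)"
    by (rule card_image_le) simp
  ultimately have inj: "inj_on ((*\<^sub>v) ?g) (carrier_vec n)"
    by (intro eq_card_imp_inj_on) (auto simp: card_carrier_vec)
  have "det ?g \<noteq> 0"
  proof
    assume "det ?g = 0"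
    then obtain v where v: "v \<in> carrier_vec n" "v \<noteq> 0\<^sub>v n" "?g *\<^sub>v v = 0\<^sub>v n"
      using det_0_iff_vec_prod_zero_field[OF g] by blast
    have "?g *\<^sub>v 0\<^sub>v n = 0\<^sub>v n" by (rule mult_mat_zero_vec[OF g])
    then show False using inj_onD[OF inj, of v "0\<^sub>v n"] v by simp
  qed
  from det_non_zero_imp_unit[OF g this, of "()"] show ?thesis
    using g by (auto simp: Units_def ring_mat_def mem_GL_iff)
qed

text \<open>Go back from \<open>bs\<close> to the standard basis with the inverse of its matrix,
  then forward to \<open>cs\<close>.\<close>

lemma GL_transitive_bases:
  fixes bs cs :: "'a::{field,finite} vec list"
  assumes "bs \<in> ind_lists n (carrier_vec n) n" "cs \<in> ind_lists n (carrier_vec n) n"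
  shows "\<exists>g\<in>GL n. map ((*\<^sub>v) g) bs = cs"
proof -
  let ?B = "mat_of_cols n bs" and ?C = "mat_of_cols n cs"
  have B: "?B \<in> GL n" and C: "?C \<in> GL n" using assms by (auto intro: mat_of_basis_GL)
  obtain B' where B': "B' \<in> GL n" "B' * ?B = 1\<^sub>m n" by (rule GL_inverse[OF B])
  have img: "map ((*\<^sub>v) (mat_of_cols n xs)) (map (unit_vec n) [0..<n]) = xs"
    if "xs \<in> ind_lists n (carrier_vec n) n" for xs :: "'a vec list"
    using that by (intro map_mat_of_cols_unit_vecs) (auto simp: ind_lists_def)
  let ?U = "map (unit_vec n) [0..<n] :: 'a vec list"
  have U: "set ?U \<subseteq> carrier_vec n" by auto
  have bsc: "set bs \<subseteq> carrier_vec n" using assms by (auto simp: ind_lists_def)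
  have "map ((*\<^sub>v) B') bs = map ((*\<^sub>v) B') (map ((*\<^sub>v) ?B) ?U)"
    using img[OF assms(1)] by simp
  also have "\<dots> = ?U"
    using map_mult_mat_vec[OF GL_carrier[OF B'(1)] GL_carrier[OF B] U] B'(2) map_one_mat_vec[OF U] by simp
  finally have "map ((*\<^sub>v) (?C * B')) bs = cs"
    using map_mult_mat_vec[OF GL_carrier[OF C] GL_carrier[OF B'(1)] bsc] img[OF assms(2)] by simp
  then show ?thesis using GL_mult[OF C B'(1)] by blast
qed

text \<open>Both lists are completed to bases at the front; an element carrying one basis to the
  other also carries the last \<open>j\<close> entries to each other.\<close>

lemma GL_transitive:
  fixes vs ws :: "'a::{field,finite} vec list"
  assumes vs: "vs \<in> ind_lists n (carrier_vec n) j" and ws: "ws \<in> ind_lists n (carrier_vec n) j"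
    and "j \<le> n"
  shows "\<exists>g\<in>GL n. map ((*\<^sub>v) g) vs = ws"
proof -
  obtain xs ys where xy: "xs @ vs \<in> ind_lists n (carrier_vec n) n" "ys @ ws \<in> ind_lists n (carrier_vec n) n"
    using assms ind_list_extend by meson
  then obtain g where g: "g \<in> GL n" "map ((*\<^sub>v) g) (xs @ vs) = ys @ ws"
    using GL_transitive_bases by blast
  have "length vs = length ws" using vs ws by (simp add: ind_lists_def)
  then show ?thesis using g by (auto simp: append_eq_append_conv)
qed

section \<open>Fixed spaces and the Burnside count\<close>

lemma vec_subspace_fixed_vecs:
  assumes "g \<in> carrier_mat n n"
  shows "vec_subspace n (fixed_vecs g)"
  using assms
  by (auto simp: vec_subspace_def fixed_vecs_def mult_add_distrib_mat_vec[OF assms] mult_mat_vec[OF assms])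

text \<open>Translates lists inside the fixed space into fixed points of the action on lists, the
  form that Burnside's lemma counts.\<close>

lemma ind_lists_fixed_vecs:
  assumes "g \<in> GL n"
  shows "ind_lists n (fixed_vecs g) j = {vs \<in> ind_lists n (carrier_vec n) j. map ((*\<^sub>v) g) vs = vs}"
proof -
  have "set vs \<subseteq> fixed_vecs g \<longleftrightarrow> set vs \<subseteq> carrier_vec n \<and> map ((*\<^sub>v) g) vs = vs" for vs
    using GL_carrier[OF assms] by (induction vs) (auto simp: fixed_vecs_def)
  then show ?thesis by (auto simp: ind_lists_def)
qed

text \<open>Burnside's lemma for the transitive action on independent \<open>j\<close>-lists; for a fixed \<open>us\<close>
  the stabilizer of \<open>vs\<close> is a translate of the fibre of \<open>g \<mapsto> g us\<close> over \<open>vs\<close>.\<close>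

lemma sum_card_fixed_ind_lists:
  assumes "j \<le> n"
  shows "(\<Sum>g\<in>GL n. card (ind_lists n (fixed_vecs (g :: 'a::{field,finite} mat)) j))
           = card (GL n :: 'a mat set)"
proof -
  let ?G = "GL n :: 'a mat set" and ?I = "ind_lists n (carrier_vec n) j :: 'a vec list set"
  have fin: "finite ?G" "finite ?I" by (auto simp: finite_GL finite_ind_lists)
  obtain bs :: "'a vec list" where bs: "bs \<in> ind_lists n (carrier_vec n) n"
    using ind_list_extend[of "[]" n 0] by (auto simp: ind_lists_def)
  have dl: "lin_ind_list n (drop i xs)" if "lin_ind_list n xs" for i and xs :: "'a vec list"
    using that by (induction xs arbitrary: i) (auto simp: drop_Cons')
  \<comment> \<open>The last \<open>j\<close> entries of a basis serve as the reference list;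
    \<open>dl\<close> makes them independent.\<close>
  define us where "us = drop (n - j) bs"
  have us: "us \<in> ?I"
    using bs dl[of bs "n - j"] assms set_drop_subset[of "n - j" bs] by (auto simp: ind_lists_def us_def)
  have usc: "set us \<subseteq> carrier_vec n" using us by (simp add: ind_lists_def)
  have fib: "card {g\<in>?G. map ((*\<^sub>v) g) vs = vs} = card {g\<in>?G. map ((*\<^sub>v) g) us = vs}"
    if vs: "vs \<in> ?I" for vs
  proof -
    have vsc: "set vs \<subseteq> carrier_vec n" using vs by (simp add: ind_lists_def)
    obtain h where h: "h \<in> ?G" "map ((*\<^sub>v) h) us = vs"
      using GL_transitive[OF us vs assms] by blast
    obtain h' where h': "h' \<in> ?G" "h * h' = 1\<^sub>m n" "h' * h = 1\<^sub>m n" by (rule GL_inverse[OF h(1)])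
    note c = GL_carrier[OF h(1)] GL_carrier[OF h'(1)]
    have h'vs: "map ((*\<^sub>v) h') vs = us"
      using map_mult_mat_vec[OF c(2,1) usc] h h' map_one_mat_vec[OF usc] by simp
    have "bij_betw (\<lambda>g. g * h) {g\<in>?G. map ((*\<^sub>v) g) vs = vs} {g\<in>?G. map ((*\<^sub>v) g) us = vs}"
    proof (rule bij_betw_byWitness[where f' = "\<lambda>g. g * h'"])
      show "\<forall>g\<in>{g\<in>?G. map ((*\<^sub>v) g) vs = vs}. g * h * h' = g"
        using c h' by (auto simp: assoc_mult_mat[of _ n n _ n _ n] dest!: GL_carrier)
      show "\<forall>g\<in>{g\<in>?G. map ((*\<^sub>v) g) us = vs}. g * h' * h = g"
        using c h' by (auto simp: assoc_mult_mat[of _ n n _ n _ n] dest!: GL_carrier)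
      show "(\<lambda>g. g * h) ` {g\<in>?G. map ((*\<^sub>v) g) vs = vs} \<subseteq> {g\<in>?G. map ((*\<^sub>v) g) us = vs}"
        using h map_mult_mat_vec[OF GL_carrier c(1) usc] GL_mult[OF _ h(1)] by (auto simp del: map_map map_eq_conv)
      show "(\<lambda>g. g * h') ` {g\<in>?G. map ((*\<^sub>v) g) us = vs} \<subseteq> {g\<in>?G. map ((*\<^sub>v) g) vs = vs}"
        using h'vs map_mult_mat_vec[OF GL_carrier c(2) vsc] GL_mult[OF _ h'(1)] by (auto simp del: map_map map_eq_conv)
    qed
    then show ?thesis by (rule bij_betw_same_card)
  qed
  have "(\<Sum>g\<in>?G. card (ind_lists n (fixed_vecs g) j)) = (\<Sum>g\<in>?G. card {vs\<in>?I. map ((*\<^sub>v) g) vs = vs})"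
    by (intro sum.cong) (auto simp: ind_lists_fixed_vecs)
  also have "\<dots> = (\<Sum>vs\<in>?I. card {g\<in>?G. map ((*\<^sub>v) g) vs = vs})"
    using sum.swap_restrict[OF fin, of "\<lambda>_ _. 1 :: nat" "\<lambda>g vs. map ((*\<^sub>v) g) vs = vs"] by simp
  also have "\<dots> = (\<Sum>vs\<in>?I. card {g\<in>?G. map ((*\<^sub>v) g) us = vs})"
    using fib by (intro sum.cong) auto
  \<comment> \<open>Each \<open>g\<close> sends \<open>us\<close> to exactly one \<open>vs\<close>,
    so the fibres partition the group.\<close>
  also have "\<dots> = card (\<Union>vs\<in>?I. {g\<in>?G. map ((*\<^sub>v) g) us = vs})"
    using fin by (intro card_UN_disjoint[symmetric]) auto
  also have "(\<Union>vs\<in>?I. {g\<in>?G. map ((*\<^sub>v) g) us = vs}) = ?G"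
    using GL_ind_lists[OF _ us] by auto
  finally show ?thesis .
qed

section \<open>Euler's expansion of the infinite product\<close>

text \<open>The coefficient of \<open>z ^ i\<close> in Euler's series for (z; p)-infinity.\<close>

definition euler_coeff :: "real \<Rightarrow> nat \<Rightarrow> real" where
  "euler_coeff p i = (- 1) ^ i * p ^ (i choose 2) / qpoch p p i"

lemma qpoch_0 [simp]: "qpoch A B 0 = 1"
  and qpoch_Suc: "qpoch A B (Suc m) = qpoch A B m * (1 - A * B ^ m)"
  by (simp_all add: qpoch_def)

lemma qpoch_pos:
  fixes A B :: real
  assumes "0 \<le> A" "A < 1" "0 < B" "B < 1"
  shows "0 < qpoch A B m"
  unfolding qpoch_def
proof (rule prod_pos)
  fix r
  have "A * B ^ r \<le> A * 1"
    using assms by (intro mult_left_mono power_le_one) auto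
  then show "0 < 1 - A * B ^ r" using assms by simp
qed

context
  fixes p :: real
  assumes p: "0 < p" "p < 1"
begin

text \<open>This recurrence drives the ratio test, the functional equation and the comparison with
  \<open>inv_coeff\<close>.\<close>

lemma euler_coeff_Suc: "euler_coeff p (Suc i) * (1 - p ^ Suc i) = - (p ^ i * euler_coeff p i)"
proof -
  have "1 - p ^ Suc i \<noteq> 0"
    using p power_Suc_less_one[of p i] by simp
  moreover have "qpoch p p i \<noteq> 0" using qpoch_pos[of p p i] p by simp
  moreover have "p ^ (Suc i choose 2) = p ^ i * p ^ (i choose 2)"
    by (simp add: numeral_2_eq_2 power_add)
  ultimately show ?thesis
    by (simp add: euler_coeff_def qpoch_Suc divide_simps)
qed

lemma summable_euler: "summable (\<lambda>i. euler_coeff p i * z ^ i)"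
proof -
  have "(\<lambda>i. \<bar>z\<bar> * p ^ i) \<longlonglongrightarrow> \<bar>z\<bar> * 0"
    using p by (intro tendsto_intros LIMSEQ_power_zero) auto
  \<comment> \<open>The threshold \<open>(1 - p) / 2\<close> absorbs the lower bound
    \<open>1 - p\<close> on \<open>1 - p ^ Suc i\<close> and leaves a ratio of
    \<open>1 / 2\<close>.\<close>
  then have "\<forall>\<^sub>F i in sequentially. \<bar>z\<bar> * p ^ i < (1 - p) / 2"
    by (rule order_tendstoD) (use p in auto)
  then obtain N where N: "\<And>i. i \<ge> N \<Longrightarrow> \<bar>z\<bar> * p ^ i < (1 - p) / 2"
    by (auto simp: eventually_sequentially)
  show ?thesis
  proof (rule summable_ratio_test[of "1 / 2" N])
    fix i assume i: "i \<ge> N"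
    have le: "p ^ Suc i \<le> p"
      using power_le_one[of p i] p by (simp add: mult_left_le)
    have "\<bar>euler_coeff p (Suc i)\<bar> * (1 - p) \<le> \<bar>euler_coeff p (Suc i)\<bar> * (1 - p ^ Suc i)"
      using le by (intro mult_left_mono) auto
    also have "\<dots> = \<bar>euler_coeff p (Suc i) * (1 - p ^ Suc i)\<bar>"
      using le p by (simp only: abs_mult)
    also have "\<dots> = p ^ i * \<bar>euler_coeff p i\<bar>"
      unfolding euler_coeff_Suc using p by (simp add: abs_mult)
    finally have "\<bar>z\<bar> ^ Suc i * (\<bar>euler_coeff p (Suc i)\<bar> * (1 - p)) \<le> \<bar>z\<bar> ^ Suc i * (p ^ i * \<bar>euler_coeff p i\<bar>)"
      by (rule mult_left_mono) simp
    also have "\<dots> = (\<bar>z\<bar> * p ^ i) * (\<bar>euler_coeff p i\<bar> * \<bar>z\<bar> ^ i)"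
      by simp
    also have "\<dots> \<le> ((1 - p) / 2) * (\<bar>euler_coeff p i\<bar> * \<bar>z\<bar> ^ i)"
      using N[OF i] by (intro mult_right_mono) auto
    finally have "(1 - p) * (\<bar>euler_coeff p (Suc i)\<bar> * \<bar>z\<bar> ^ Suc i) \<le> (1 - p) * (1 / 2 * (\<bar>euler_coeff p i\<bar> * \<bar>z\<bar> ^ i))"
      by (simp add: mult_ac)
    then show "norm (euler_coeff p (Suc i) * z ^ Suc i) \<le> 1 / 2 * norm (euler_coeff p i * z ^ i)"
      using p by (simp only: mult_le_cancel_left_pos abs_mult power_abs real_norm_def)
  qed simp
qed

definition euler_fun :: "real \<Rightarrow> real" where
  "euler_fun z = (\<Sum>i. euler_coeff p i * z ^ i)"

text \<open>Subtracting the series at \<open>z * p\<close> cancels the constant term and inserts the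
  factor \<open>1 - p ^ i\<close>, which the coefficient recurrence trades for an index
  shift.\<close>

lemma euler_fun_eq: "euler_fun z = (1 - z) * euler_fun (z * p)"
proof -
  have s: "(\<lambda>i. euler_coeff p i * w ^ i) sums euler_fun w" for w
    unfolding euler_fun_def by (rule summable_sums[OF summable_euler])
  have d: "(\<lambda>i. euler_coeff p i * z ^ i - euler_coeff p i * (z * p) ^ i) sums (euler_fun z - euler_fun (z * p))"
    by (rule sums_diff[OF s s])
  have "euler_coeff p (Suc i) * z ^ Suc i - euler_coeff p (Suc i) * (z * p) ^ Suc i
      = - z * (euler_coeff p i * (z * p) ^ i)" for i
  proof -
    have "euler_coeff p (Suc i) * z ^ Suc i - euler_coeff p (Suc i) * (z * p) ^ Suc i
       = z ^ Suc i * (euler_coeff p (Suc i) * (1 - p ^ Suc i))"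
      by (simp add: power_mult_distrib algebra_simps)
    then show ?thesis
      unfolding euler_coeff_Suc by (simp add: power_mult_distrib algebra_simps)
  qed
  then have "(\<lambda>i. - z * (euler_coeff p i * (z * p) ^ i)) sums (euler_fun z - euler_fun (z * p))"
    using d sums_Suc_iff[of "\<lambda>i. euler_coeff p i * z ^ i - euler_coeff p i * (z * p) ^ i"]
    by simp
  then have "euler_fun z - euler_fun (z * p) = - z * euler_fun (z * p)"
    using sums_mult[OF s, of "- z"] sums_unique2 by blast
  then show ?thesis by (simp add: algebra_simps)
qed

lemma euler_fun_qpoch: "euler_fun z = qpoch z p m * euler_fun (z * p ^ m)"
proof (induction m)
  case (Suc m)
  then show ?case
    using euler_fun_eq[of "z * p ^ m"] by (simp add: qpoch_Suc mult_ac)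
qed simp

text \<open>Iterating the functional equation leaves the factor
  \<open>euler_fun (z * p ^ m)\<close>, which tends to \<open>euler_fun 0 = 1\<close> by continuity,
  while the finite products tend to the infinite one.\<close>

lemma qpoch_inf_eq_euler_fun: "qpoch_inf z p = euler_fun z"
proof -
  have "(\<lambda>m. z * p ^ m) \<longlonglongrightarrow> z * 0"
    using p by (intro tendsto_intros LIMSEQ_power_zero) auto
  moreover have "isCont euler_fun (z * 0)"
    unfolding euler_fun_def by (rule isCont_powser_converges_everywhere[OF summable_euler])
  ultimately have "(\<lambda>m. euler_fun (z * p ^ m)) \<longlonglongrightarrow> euler_fun (z * 0)"
    by (rule isCont_tendsto_compose[rotated])
  moreover have "euler_fun (z * 0) = 1"
    unfolding euler_fun_def mult_zero_right powser_zero by (simp add: euler_coeff_def numeral_2_eq_2)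
  ultimately have lim1: "(\<lambda>m. euler_fun (z * p ^ m)) \<longlonglongrightarrow> 1" by simp
  have "summable (\<lambda>r. norm (- (z * p ^ r)))"
    using p by (simp add: abs_mult power_abs summable_mult)
  then have "convergent_prod (\<lambda>r. 1 + - (z * p ^ r))"
    by (intro abs_convergent_prod_imp_convergent_prod summable_imp_abs_convergent_prod) simp
  then have "(\<lambda>n. \<Prod>r\<le>n. 1 - z * p ^ r) \<longlonglongrightarrow> qpoch_inf z p"
    unfolding qpoch_inf_def using convergent_prod_LIMSEQ by fastforce
  then have "(\<lambda>n. qpoch z p (Suc n)) \<longlonglongrightarrow> qpoch_inf z p"
    by (simp add: qpoch_def lessThan_Suc_atMost)
  then have "(\<lambda>n. qpoch z p n) \<longlonglongrightarrow> qpoch_inf z p"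
    by (rule LIMSEQ_imp_Suc)
  from tendsto_mult[OF this lim1] have "(\<lambda>n. euler_fun z) \<longlonglongrightarrow> qpoch_inf z p"
    using euler_fun_qpoch[of z] by simp
  then show ?thesis by (simp add: LIMSEQ_const_iff)
qed

lemma qpoch_inf_shift: "qpoch_inf z p = qpoch z p m * qpoch_inf (z * p ^ m) p"
  using euler_fun_qpoch[of z m] by (simp add: qpoch_inf_eq_euler_fun)

lemma euler_sums: "(\<lambda>i. euler_coeff p i * z ^ i) sums qpoch_inf z p"
  unfolding qpoch_inf_eq_euler_fun euler_fun_def by (rule summable_sums[OF summable_euler])

text \<open>The Cauchy product with the geometric series asks for absolute convergence; it follows
  from convergence at a point of larger modulus.\<close>

lemma summable_abs_euler: "summable (\<lambda>i. norm (euler_coeff p i * z ^ i))"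
proof -
  have "summable (\<lambda>i. euler_coeff p i * (\<bar>z\<bar> + 1) ^ i)" by (rule summable_euler)
  then show ?thesis by (rule powser_insidea) simp
qed

end

section \<open>Inverting the factorial moments\<close>

text \<open>The factor multiplying \<open>(X - 1) (X - q) \<cdots> (X - q ^ (k + i - 1))\<close> in the expansion of
  the indicator of \<open>X = q ^ k\<close> on powers of \<open>q\<close>.\<close>

definition inv_coeff :: "real \<Rightarrow> nat \<Rightarrow> nat \<Rightarrow> real" where
  "inv_coeff q k i =
     (- 1) ^ i / (q ^ (k * i) * (\<Prod>s<k. q ^ k - q ^ s) * (\<Prod>s<i. q ^ Suc s - 1))"

text \<open>The next summand is the current closed form times
  \<open>(1 - x) / (q ^ Suc r - 1)\<close>, and adding 1 to this quotient gives the next factor. At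
  \<open>x = 1\<close> the right side is 1; at \<open>x = q ^ d\<close> with
  \<open>1 \<le> d \<le> r\<close> it is 0.\<close>

lemma telescoping_q_sum:
  fixes q x :: real
  assumes q: "q > 1"
  shows "(\<Sum>i\<le>r. \<Prod>s<i. (q ^ s - x) / (q ^ Suc s - 1)) = (\<Prod>s<r. (q ^ Suc s - x) / (q ^ Suc s - 1))"
proof (induction r)
  case (Suc r)
  have ne: "q ^ Suc s - 1 \<noteq> 0" for s
    using q one_less_power[of q "Suc s"] by simp
  let ?P = "\<Prod>s<r. (q ^ Suc s - x) / (q ^ Suc s - 1)"
  have "(\<Prod>s<Suc r. (q ^ s - x) / (q ^ Suc s - 1)) = (\<Prod>s<Suc r. q ^ s - x) / (\<Prod>s<Suc r. q ^ Suc s - 1)"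
    by (rule prod_dividef)
  also have "(\<Prod>s<Suc r. q ^ s - x) = (1 - x) * (\<Prod>s<r. q ^ Suc s - x)"
    by (subst prod.lessThan_Suc_shift) simp
  also have "(1 - x) * (\<Prod>s<r. q ^ Suc s - x) / (\<Prod>s<Suc r. q ^ Suc s - 1) = ?P * ((1 - x) / (q ^ Suc r - 1))"
    by (simp add: prod_dividef)
  finally have "(\<Sum>i\<le>Suc r. \<Prod>s<i. (q ^ s - x) / (q ^ Suc s - 1)) = ?P * (1 + (1 - x) / (q ^ Suc r - 1))"
    using Suc by (simp add: algebra_simps)
  also have "1 + (1 - x) / (q ^ Suc r - 1) = (q ^ Suc r - x) / (q ^ Suc r - 1)"
    using ne[of r] by (simp add: field_simps)
  finally show ?case by simp
qed simp

text \<open>For \<open>m < k\<close> every product has a zero factor. For \<open>m = k + d\<close> a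
  constant splits off and the telescoping sum at \<open>x = q ^ d\<close> remains; the bound on
  \<open>m\<close> gives \<open>d \<le> r\<close>, so a zero factor occurs unless
  \<open>d = 0\<close>.\<close>

lemma indicator_expansion:
  fixes q :: real
  assumes q: "q > 1" and "m \<le> k + r"
  shows "(\<Sum>i\<le>r. inv_coeff q k i * (\<Prod>s<k + i. q ^ m - q ^ s)) = of_bool (m = k)"
proof (cases "m < k")
  case True
  have "(\<Prod>s<k + i. q ^ m - q ^ s) = 0" for i
    using True by (intro prod_zero) auto
  then show ?thesis using True by (simp only: mult_zero_right sum.neutral_const) simp
next
  case False
  then obtain d where d: "m = k + d" "d \<le> r" using assms(2) by (metis add_le_cancel_left leI le_iff_add)
  \<comment> \<open>The factor with index \<open>k + s\<close> is
    \<open>- (q ^ k) * (q ^ s - q ^ d)\<close>; the signs and powers of \<open>q ^ k\<close> cancel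
    against \<open>inv_coeff\<close>.\<close>
  have split: "(\<Prod>s<k + i. q ^ m - q ^ s) = (\<Prod>s<k. q ^ m - q ^ s) * ((- 1) ^ i * q ^ (k * i) * (\<Prod>s<i. q ^ s - q ^ d))" for i
  proof (induction i)
    case (Suc i)
    have "q ^ m - q ^ (k + i) = - (q ^ k) * (q ^ i - q ^ d)"
      by (simp add: d power_add algebra_simps)
    then show ?case using Suc by (simp add: power_add mult_ac)
  qed simp
  let ?c = "(\<Prod>s<k. q ^ m - q ^ s) / (\<Prod>s<k. q ^ k - q ^ s)"
  have "inv_coeff q k i * (\<Prod>s<k + i. q ^ m - q ^ s) = ?c * (\<Prod>s<i. (q ^ s - q ^ d) / (q ^ Suc s - 1))" for i
  proof -
    have "(- 1 :: real) ^ i * (- 1) ^ i = 1" by (simp flip: power_mult_distrib)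
    then have "inv_coeff q k i * (\<Prod>s<k + i. q ^ m - q ^ s)
      = (q ^ (k * i) / q ^ (k * i)) * ?c * ((\<Prod>s<i. q ^ s - q ^ d) / (\<Prod>s<i. q ^ Suc s - 1))"
      unfolding split inv_coeff_def by (simp add: mult_ac)
    then show ?thesis using q by (simp add: prod_dividef)
  qed
  then have "(\<Sum>i\<le>r. inv_coeff q k i * (\<Prod>s<k + i. q ^ m - q ^ s))
      = ?c * (\<Prod>s<r. (q ^ Suc s - q ^ d) / (q ^ Suc s - 1))"
    using telescoping_q_sum[OF q] by (simp only: sum_distrib_left[symmetric])
  also have "\<dots> = of_bool (m = k)"
  proof (cases d)
    case 0
    have "q ^ Suc s - 1 \<noteq> 0" for s
      using q one_less_power[of q "Suc s"] by simp
    moreover have "(\<Prod>s<k. q ^ k - q ^ s) \<noteq> 0"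
      using q by (auto simp: prod_zero_iff)
    ultimately show ?thesis using 0 d by simp
  next
    case (Suc d')
    then have "(\<Prod>s<r. (q ^ Suc s - q ^ d) / (q ^ Suc s - 1)) = 0"
      using d by (intro prod_zero) auto
    then show ?thesis using Suc d by simp
  qed
  finally show ?thesis .
qed

text \<open>Both sides satisfy the same recurrence in \<open>i\<close>, and \<open>i = 0\<close>
  yields the factor in front. Summing over \<open>i\<close> therefore gives Euler's series at
  \<open>a * p * p ^ k\<close>.\<close>

lemma inv_coeff_eq_euler:
  assumes p: "0 < p" "p < 1"
  shows "inv_coeff (1 / p) k i * a ^ i = p ^ k\<^sup>2 / qpoch p p k * (euler_coeff p i * (a * p * p ^ k) ^ i)"
proof (induction i)
  case 0
  \<comment> \<open>Taking \<open>(1 / p) ^ k\<close> out of each of the \<open>k\<close> factors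
    leaves those of \<open>qpoch p p k\<close> in reverse order.\<close>
  have "(\<Prod>s<k. (1 / p) ^ k - (1 / p) ^ s) = (\<Prod>s<k. (1 / p) ^ k * (1 - p * p ^ (k - Suc s)))"
  proof (rule prod.cong[OF refl])
    fix s assume "s \<in> {..<k}"
    then have "p ^ k = p ^ s * (p * p ^ (k - Suc s))"
      by (simp flip: power_Suc power_add)
    then show "(1 / p) ^ k - (1 / p) ^ s = (1 / p) ^ k * (1 - p * p ^ (k - Suc s))"
      using p by (simp add: field_simps)
  qed
  also have "\<dots> = (1 / p) ^ (k\<^sup>2) * (\<Prod>s<k. 1 - p * p ^ (k - Suc s))"
    by (simp add: prod.distrib power2_eq_square power_mult)
  also have "(\<Prod>s<k. 1 - p * p ^ (k - Suc s)) = qpoch p p k"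
    unfolding qpoch_def by (rule prod.nat_diff_reindex)
  finally show ?case
    by (simp add: inv_coeff_def euler_coeff_def power_one_over numeral_2_eq_2)
next
  case (Suc i)
  have ne: "1 - p ^ Suc i \<noteq> 0" using p power_Suc_less_one[of p i] by simp
  have "inv_coeff (1 / p) k (Suc i) = inv_coeff (1 / p) k i * (- 1 / ((1 / p) ^ k * ((1 / p) ^ Suc i - 1)))"
    by (simp add: inv_coeff_def power_add mult_ac)
  also have "- 1 / ((1 / p) ^ k * ((1 / p) ^ Suc i - 1)) = - (p ^ k * p ^ Suc i) / (1 - p ^ Suc i)"
    using p ne by (simp add: power_one_over field_simps)
  finally have "inv_coeff (1 / p) k (Suc i) * a ^ Suc i
      = (inv_coeff (1 / p) k i * a ^ i) * (a * - (p ^ k * p ^ Suc i) / (1 - p ^ Suc i))"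
    by simp
  also have "\<dots> = p ^ k\<^sup>2 / qpoch p p k * ((- (p ^ i * euler_coeff p i) / (1 - p ^ Suc i)) * (a * p * p ^ k) ^ Suc i)"
    unfolding Suc by simp
  also have "- (p ^ i * euler_coeff p i) / (1 - p ^ Suc i) = euler_coeff p (Suc i)"
    unfolding euler_coeff_Suc[OF p, symmetric] using ne by simp
  finally show ?case .
qed

section \<open>The distribution of the dimension of the fixed space\<close>

text \<open>The indicator expansion is summed over the group, and the Burnside count turns every
  moment into \<open>card (GL n)\<close>. Stopping at \<open>i = n - k\<close> serves both: fixed
  spaces have dimension at most \<open>n\<close>, so the expansion is exact, and
  \<open>k + i \<le> n\<close>, so each count applies.\<close>

lemma prob_fixed_vecs_GL:
  assumes q: "q = CARD('a::{field,finite})"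
  shows "measure_pmf.prob (pmf_of_set (GL n :: 'a mat set)) {g. card (fixed_vecs g) = q ^ k}
           = (if k \<le> n then \<Sum>i\<le>n - k. inv_coeff (real q) k i else 0)"
proof -
  let ?G = "GL n :: 'a mat set" and ?S = "{g :: 'a mat. card (fixed_vecs g) = q ^ k}"
  have G: "finite ?G" "?G \<noteq> {}" using finite_GL one_mem_GL by auto
  then have cG: "real (card ?G) \<noteq> 0" by simp
  have q1: "1 < q"
    using one_less_card_field[where 'a = 'a] q by simp
  have prob: "measure_pmf.prob (pmf_of_set ?G) ?S = real (card (?G \<inter> ?S)) / real (card ?G)"
    using G by (simp add: measure_pmf_of_set)
  have dim: "\<exists>m\<le>n. card (fixed_vecs g) = q ^ m" if "g \<in> ?G" for g
    using card_vec_subspace[OF vec_subspace_fixed_vecs[OF GL_carrier[OF that]]] q by metis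
  show ?thesis
  proof (cases "k \<le> n")
    case True
    have "real (card (?G \<inter> ?S)) = (\<Sum>g\<in>?G. of_bool (g \<in> ?S))"
      using G(1) by (simp add: Int_def)
    also have "\<dots> = (\<Sum>g\<in>?G. \<Sum>i\<le>n - k. inv_coeff (real q) k i * real (card (ind_lists n (fixed_vecs g) (k + i))))"
    proof (rule sum.cong[OF refl])
      fix g assume g: "g \<in> ?G"
      obtain m where m: "m \<le> n" "card (fixed_vecs g) = q ^ m" using dim[OF g] by auto
      have "real (card (ind_lists n (fixed_vecs g) (k + i))) = (\<Prod>s<k + i. real q ^ m - real q ^ s)" for i
        using card_ind_lists[OF vec_subspace_fixed_vecs[OF GL_carrier[OF g]], of "k + i"] m q by simp
      moreover have "g \<in> ?S \<longleftrightarrow> m = k" using m q1 by simp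
      ultimately show "of_bool (g \<in> ?S) = (\<Sum>i\<le>n - k. inv_coeff (real q) k i * real (card (ind_lists n (fixed_vecs g) (k + i))))"
        using indicator_expansion[of "real q" m k "n - k"] q1 m True by simp
    qed
    also have "\<dots> = (\<Sum>i\<le>n - k. inv_coeff (real q) k i * real (\<Sum>g\<in>?G. card (ind_lists n (fixed_vecs g) (k + i))))"
      by (subst sum.swap) (simp add: sum_distrib_left)
    also have "\<dots> = (\<Sum>i\<le>n - k. inv_coeff (real q) k i * real (card ?G))"
      using True by (intro sum.cong refl) (simp add: sum_card_fixed_ind_lists del: of_nat_sum)
    finally show ?thesis
      using prob cG True by (simp flip: sum_distrib_right)
  next
    case False
    have "?G \<inter> ?S = {}"
      using dim q1 False by fastforce
    then show ?thesis using prob False by simp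
  qed
qed

text \<open>Total probability over the drawn dimension. The sum is formed in \<open>ennreal\<close>
  and returns to the reals because a geometric series dominates it.\<close>

lemma prob_bind_geometric_sums:
  assumes a: "0 < a" "a < 1"
  shows "(\<lambda>n. (1 - a) * a ^ n * measure_pmf.prob (f n) S)
           sums measure_pmf.prob (bind_pmf (geometric_pmf (1 - a)) f) S"
proof -
  let ?h = "\<lambda>n. (1 - a) * a ^ n * measure_pmf.prob (f n) S"
  have nonneg: "0 \<le> ?h n" for n using a by simp
  have "summable (\<lambda>n. (1 - a) * a ^ n)" using a by (intro summable_mult summable_geometric) simp
  then have sm: "summable ?h"
    by (rule summable_comparison_test'[of _ 0]) (use a in \<open>simp add: abs_mult mult_left_le\<close>)
  have "emeasure (bind_pmf (geometric_pmf (1 - a)) f) S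
      = (\<Sum>n. ennreal (pmf (geometric_pmf (1 - a)) n) * emeasure (f n) S)"
    by (simp only: emeasure_bind_pmf nn_integral_measure_pmf nn_integral_count_space_nat)
  also have "\<dots> = (\<Sum>n. ennreal (?h n))"
    using a by (simp add: measure_pmf.emeasure_eq_measure ennreal_mult' mult_ac)
  also have "\<dots> = ennreal (suminf ?h)"
    by (rule suminf_ennreal2[OF nonneg sm])
  finally have "measure_pmf.prob (bind_pmf (geometric_pmf (1 - a)) f) S = suminf ?h"
    using suminf_nonneg[OF sm nonneg] by (simp add: measure_pmf.emeasure_eq_measure)
  then show ?thesis using summable_sums[OF sm] by simp
qed

lemma w_AC_powi:
  assumes p: "0 < p" "p < 1"
  shows "w_AC (p powi (- int k)) a p
           = qpoch_inf (a * p) p * (p ^ (k\<^sup>2) * a ^ k / (qpoch p p k * qpoch (a * p) p k))"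
proof -
  have inj: "p powi (- int k) = p powi (- int j) \<longleftrightarrow> k = j" for j
    using p power_inject_exp'[of p k j] by (auto simp: power_int_minus)
  show ?thesis unfolding w_AC_def inj by (auto simp: Let_def)
qed

theorem theorem5p7:
  fixes q :: nat and a p :: real and k :: nat
  assumes "q = CARD('a::{field,finite})"
    and "0 < a" and "a < 1"
    and "p = 1 / real q"
  shows "measure_pmf.prob (random_GL a :: 'a mat pmf) {g. card (fixed_vecs g) = q ^ k}
           = w_AC (p powi (- int k)) a p
       \<and> w_AC (p powi (- int k)) a p
           = qpoch_inf (a * p) p * (p ^ (k\<^sup>2) * a ^ k / (qpoch p p k * qpoch (a * p) p k))"
proof -
  note a = \<open>0 < a\<close> \<open>a < 1\<close>
  have "1 < q"
    using one_less_card_field[where 'a = 'a] assms(1) by simp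
  then have p: "0 < p" "p < 1" using assms(4) by auto
  have q: "real q = 1 / p" using assms(4) by simp
  let ?S = "{g :: 'a mat. card (fixed_vecs g) = q ^ k}"
  let ?P = "measure_pmf.prob (random_GL a :: 'a mat pmf) ?S"
  let ?c = "\<lambda>i. inv_coeff (real q) k i * a ^ i" and ?z = "a * p * p ^ k"
  let ?C = "p ^ k\<^sup>2 / qpoch p p k"
  have ce: "?c = (\<lambda>i. ?C * (euler_coeff p i * ?z ^ i))"
    unfolding q by (rule ext) (rule inv_coeff_eq_euler[OF p])
  have "summable (\<lambda>i. norm ?C * norm (euler_coeff p i * ?z ^ i))"
    by (intro summable_mult summable_abs_euler[OF p])
  then have sc: "summable (\<lambda>i. norm (?c i))"
    unfolding fun_cong[OF ce] norm_mult[of ?C] .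
  have "?c sums (?C * qpoch_inf ?z p)"
    unfolding ce by (intro sums_mult euler_sums[OF p])
  then have "suminf ?c = ?C * qpoch_inf ?z p" by (simp add: sums_iff)
  moreover have "(\<Sum>i. a ^ i) = 1 / (1 - a)" using a by (simp add: suminf_geometric)
  moreover have "summable (\<lambda>i. norm (a ^ i))" using a by (simp add: power_abs)
  \<comment> \<open>Multiplying by the geometric series for \<open>1 / (1 - a)\<close> creates the
    partial sums of \<open>inv_coeff\<close>, since the powers of \<open>a\<close> in each term
    combine to \<open>a ^ n\<close>. The factor \<open>1 - a\<close> of the geometric weight later
    cancels the quotient.\<close>
  ultimately have
    "(\<lambda>n. \<Sum>i\<le>n. ?c i * a ^ (n - i)) sums (?C * qpoch_inf ?z p * (1 / (1 - a)))"
    using Cauchy_product_sums[OF sc, of "\<lambda>i. a ^ i"] by simp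
  then have "(\<lambda>n. (1 - a) * a ^ k * (\<Sum>i\<le>n. ?c i * a ^ (n - i)))
      sums ((1 - a) * a ^ k * (?C * qpoch_inf ?z p * (1 / (1 - a))))"
    by (rule sums_mult)
  moreover have "(\<Sum>i\<le>n. ?c i * a ^ (n - i)) = a ^ n * (\<Sum>i\<le>n. inv_coeff (real q) k i)" for n
    unfolding sum_distrib_left by (intro sum.cong refl) (simp flip: power_add)
  ultimately have
    s: "(\<lambda>n. (1 - a) * a ^ (n + k) * (\<Sum>i\<le>n. inv_coeff (real q) k i)) sums (a ^ k * (?C * qpoch_inf ?z p))"
    using a by (simp add: power_add mult_ac)
  let ?h = "\<lambda>n. (1 - a) * a ^ n * measure_pmf.prob (pmf_of_set (GL n :: 'a mat set)) ?S"
  have h: "?h sums ?P"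
    unfolding random_GL_def by (rule prob_bind_geometric_sums[OF a])
  have hk: "?h (n + k) = (1 - a) * a ^ (n + k) * (\<Sum>i\<le>n. inv_coeff (real q) k i)" for n
    unfolding prob_fixed_vecs_GL[OF assms(1)] by simp
  have "(\<lambda>n. ?h (n + k)) sums (a ^ k * (?C * qpoch_inf ?z p))"
    unfolding hk by (rule s)
  \<comment> \<open>A space of dimension below \<open>k\<close> has fewer than \<open>q ^ k\<close>
    vectors, so dropping the first \<open>k\<close> terms keeps the sum.\<close>
  moreover have "?h n = 0" if "n < k" for n
    unfolding prob_fixed_vecs_GL[OF assms(1)] using that by simp
  ultimately have "?h sums (a ^ k * (?C * qpoch_inf ?z p))"
    using sums_zero_iff_shift[of k ?h] by blast
  then have "?P = a ^ k * (?C * qpoch_inf ?z p)" using h sums_unique2 by blast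
  \<comment> \<open>Removing the first \<open>k\<close> factors of (a p; p)-infinity leaves the
    product that starts at \<open>a * p * p ^ k\<close>.\<close>
  moreover have "qpoch_inf ?z p = qpoch_inf (a * p) p / qpoch (a * p) p k"
  proof -
    have "a * p < 1" using a p mult_strict_mono[of a 1 p 1] by simp
    then have "qpoch (a * p) p k \<noteq> 0" using qpoch_pos[of "a * p" p k] a p by simp
    then show ?thesis using qpoch_inf_shift[OF p, of "a * p" k] by simp
  qed
  ultimately have "?P = qpoch_inf (a * p) p * (p ^ (k\<^sup>2) * a ^ k / (qpoch p p k * qpoch (a * p) p k))"
    by simp
  then show ?thesis using w_AC_powi[OF p] by simp
qed

end
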